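(* Let $A\in\mathbb{C}^{n\times n}$ be power nonnegative and such that $A^k$ is nonnegative and irreducible for some $k\ge\nu(A)$. If $q=\gcd(\nu(A),k)$, then $A^q$ is eventually nonnegative.
   Context: $M\ge O$ (nonnegative) means that all entries of $M$ are real and $\ge0$. $A$ is power nonnegative if $A^k\ge O$ for some integer $k\ge1$, and then $\nu(A)=\min\{k\ge1:A^k\ge O\}$. A complex square matrix $B$ is eventually nonnegative if there is $k_0$ such that $B^k\ge O$ for all integers $k\ge k_0$. A square matrix $A$ is reducible if there is a permutation matrix $P$ such that $PAP^{T}=\begin{pmatrix} X & O \\ W & Y \end{pmatrix}$ with square diagonal blocks $X,Y$; otherwise it is irreducible. *)

theory Defs
  imports
    Complex_Main
    "HOL-Library.Nonpos_Ints"
    "HOL-Combinatorics.Permutations"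
    "Jordan_Normal_Form.Matrix"
begin

definition nonneg_mat :: "complex mat \<Rightarrow> bool" where
  "nonneg_mat M \<longleftrightarrow> elements_mat M \<subseteq> \<real>\<^sub>\<ge>\<^sub>0"

definition power_nonneg_mat :: "complex mat \<Rightarrow> bool" where
  "power_nonneg_mat A \<longleftrightarrow> square_mat A \<and> (\<exists>k\<ge>1. nonneg_mat (A ^\<^sub>m k))"

(* Meaningful only for power nonnegative A; the value is otherwise unspecified. *)
definition power_nonneg_index :: "complex mat \<Rightarrow> nat" where
  "power_nonneg_index A = (LEAST k. k \<ge> 1 \<and> nonneg_mat (A ^\<^sub>m k))"

definition eventually_nonneg_mat :: "complex mat \<Rightarrow> bool" where
  "eventually_nonneg_mat B \<longleftrightarrow> square_mat B \<and> (\<exists>k0. \<forall>k\<ge>k0. nonneg_mat (B ^\<^sub>m k))"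

definition permutation_mat :: "nat \<Rightarrow> complex mat \<Rightarrow> bool" where
  "permutation_mat n P \<longleftrightarrow>
     (\<exists>p. p permutes {..<n} \<and> P = mat n n (\<lambda>(i, j). if j = p i then 1 else 0))"

(* The diagonal blocks X and Y are required to be nonempty; otherwise every square matrix
   would be reducible.  In particular every 1 x 1 matrix, also the zero matrix, is irreducible. *)
definition reducible_mat :: "complex mat \<Rightarrow> bool" where
  "reducible_mat A \<longleftrightarrow> square_mat A \<and>
     (\<exists>P r s X W Y. permutation_mat (dim_row A) P \<and> r > 0 \<and> s > 0 \<and>
        X \<in> carrier_mat r r \<and> W \<in> carrier_mat s r \<and> Y \<in> carrier_mat s s \<and>
        P * A * transpose_mat P = four_block_mat X (0\<^sub>m r s) W Y)"

definition irreducible_mat :: "complex mat \<Rightarrow> bool" where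
  "irreducible_mat A \<longleftrightarrow> square_mat A \<and> \<not> reducible_mat A"

end

theory Submission
  imports Defs
begin

text \<open>
  The exponents \<open>j\<close> with \<open>A\<^sup>j \<ge> O\<close> form a submonoid of the natural numbers, because the
  identity matrix is nonnegative and nonnegative matrices are closed under multiplication
  (\<open>nonneg_mat_mult\<close>).  This submonoid contains the power index of \<open>A\<close> and \<open>k\<close>, and a submonoid
  containing two numbers contains every sufficiently large multiple of their greatest common
  divisor (\<open>large_multiple_of_gcd\<close>).  So the large powers of \<open>A\<^sup>q\<close> are products of
  nonnegative powers of \<open>A\<close>.
\<close>

text \<open>
  Bezout writes \<open>gcd a b\<close> as \<open>a * x - b * y\<close>.  Up to a multiple of \<open>b\<close>, the number
  \<open>m * gcd a b\<close> is \<open>r * gcd a b = a * (r * x) - b * (r * y)\<close> with \<open>r < b div gcd a b\<close>.  The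
  negative term is thus bounded independently of \<open>m\<close>, and for large \<open>m\<close> the multiple of \<open>b\<close>
  that was split off absorbs it.
\<close>

lemma large_multiple_of_gcd:
  fixes a b :: nat
  assumes "a \<noteq> 0" "b \<noteq> 0"
  shows "\<exists>m0. \<forall>m\<ge>m0. \<exists>x y. m * gcd a b = a * x + b * y"
proof -
  obtain x y where bezout: "a * x = b * y + gcd a b"
    using bezout_nat[OF assms(1)] by blast
  define b' where "b' = b div gcd a b"
  have b: "b' * gcd a b = b" by (simp add: b'_def)
  with assms(2) have "b' > 0" by (cases b') auto
  show ?thesis
  proof (rule exI[of _ "b' * (b' * y)"], intro allI impI)
    fix m assume m: "b' * (b' * y) \<le> m"
    define c r where "c = m div b'" and "r = m mod b'"
    have "r * y \<le> b' * y" using \<open>b' > 0\<close> by (simp add: r_def less_imp_le)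
    also have "b' * y \<le> c"
      using div_le_mono[OF m, of b'] \<open>b' > 0\<close> by (simp add: c_def)
    finally obtain d where c: "c = r * y + d" using le_Suc_ex by blast
    have "m = c * b' + r" by (simp add: c_def r_def)
    then have "m * gcd a b = c * (b' * gcd a b) + r * gcd a b"
      by (simp add: algebra_simps)
    also have "\<dots> = c * b + r * gcd a b" by (simp only: b)
    also have "\<dots> = r * (b * y + gcd a b) + b * d"
      by (simp add: c algebra_simps)
    also have "\<dots> = a * (r * x) + b * d"
      by (simp only: bezout[symmetric] mult.left_commute)
    finally show "\<exists>x y. m * gcd a b = a * x + b * y" by blast
  qed
qed

lemma nonneg_mat_iff:
  assumes "M \<in> carrier_mat r c"
  shows "nonneg_mat M \<longleftrightarrow> (\<forall>i<r. \<forall>j<c. M $$ (i, j) \<in> \<real>\<^sub>\<ge>\<^sub>0)"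
  using assms unfolding nonneg_mat_def by fastforce

lemma nonneg_mat_one: "nonneg_mat (1\<^sub>m n)"
  by (auto simp: nonneg_mat_iff[OF one_carrier_mat])

lemma sum_in_nonneg_Reals:
  assumes "\<And>x. x \<in> S \<Longrightarrow> f x \<in> \<real>\<^sub>\<ge>\<^sub>0"
  shows "sum f S \<in> \<real>\<^sub>\<ge>\<^sub>0"
  using assms by (induction S rule: infinite_finite_induct) auto

lemma nonneg_mat_mult:
  assumes "M \<in> carrier_mat r s" "N \<in> carrier_mat s t" "nonneg_mat M" "nonneg_mat N"
  shows "nonneg_mat (M * N)"
  unfolding nonneg_mat_iff[OF mult_carrier_mat[OF assms(1,2)]]
proof (intro allI impI)
  fix i j assume "i < r" "j < t"
  then have "(M * N) $$ (i, j) = (\<Sum>l<s. M $$ (i, l) * N $$ (l, j))"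
    using assms(1,2) by (auto simp: scalar_prod_def lessThan_atLeast0 intro!: sum.cong)
  also have "\<dots> \<in> \<real>\<^sub>\<ge>\<^sub>0"
    using assms \<open>i < r\<close> \<open>j < t\<close>
    by (intro sum_in_nonneg_Reals nonneg_Reals_mult_I)
       (auto simp: nonneg_mat_iff[OF assms(1)] nonneg_mat_iff[OF assms(2)])
  finally show "(M * N) $$ (i, j) \<in> \<real>\<^sub>\<ge>\<^sub>0" .
qed

lemma nonneg_mat_pow:
  assumes "M \<in> carrier_mat n n" "nonneg_mat M"
  shows "nonneg_mat (M ^\<^sub>m x)"
  using assms by (induction x) (auto intro: nonneg_mat_one nonneg_mat_mult[OF pow_carrier_mat])

lemma pow_mat_add:
  fixes M :: "'a :: semiring_1 mat"
  assumes "M \<in> carrier_mat n n"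
  shows "M ^\<^sub>m (x + y) = M ^\<^sub>m x * M ^\<^sub>m y"
  using assms pow_carrier_mat[OF assms]
  by (induction y) (simp_all add: assoc_mult_mat[of _ n n _ n _ n])

lemma pow_mat_mult:
  fixes M :: "'a :: semiring_1 mat"
  assumes "M \<in> carrier_mat n n"
  shows "M ^\<^sub>m (x * y) = (M ^\<^sub>m x) ^\<^sub>m y"
proof (induction y)
  case 0
  show ?case by simp
next
  case (Suc y)
  have "x * Suc y = x * y + x" by simp
  then show ?case by (simp only: pow_mat_add[OF assms] pow_mat.simps Suc)
qed

theorem corollary4p1:
  fixes A :: "complex mat" and n k q :: nat
  assumes "A \<in> carrier_mat n n"
    and "power_nonneg_mat A"
    and "k \<ge> power_nonneg_index A"
    and "nonneg_mat (A ^\<^sub>m k)"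
    and "irreducible_mat (A ^\<^sub>m k)"
    and "q = gcd (power_nonneg_index A) k"
  shows "eventually_nonneg_mat (A ^\<^sub>m q)"
proof -
  let ?v = "power_nonneg_index A"
  have A: "A ^\<^sub>m j \<in> carrier_mat n n" for j using assms(1) by simp
  have v: "?v \<ge> 1 \<and> nonneg_mat (A ^\<^sub>m ?v)"
    unfolding power_nonneg_index_def
    by (rule LeastI_ex) (use assms(2) in \<open>simp add: power_nonneg_mat_def\<close>)
  then have "?v \<noteq> 0" "k \<noteq> 0" using assms(3) by auto
  then obtain m0 where m0: "\<exists>x y. m * q = ?v * x + k * y" if "m \<ge> m0" for m
    using large_multiple_of_gcd[of ?v k] unfolding assms(6) by blast
  have "nonneg_mat ((A ^\<^sub>m q) ^\<^sub>m m)" if "m \<ge> m0" for m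
  proof -
    obtain x y where "m * q = ?v * x + k * y" using m0[OF \<open>m \<ge> m0\<close>] by blast
    then have "(A ^\<^sub>m q) ^\<^sub>m m = (A ^\<^sub>m ?v) ^\<^sub>m x * (A ^\<^sub>m k) ^\<^sub>m y"
      by (simp only: pow_mat_mult[OF assms(1), symmetric] pow_mat_add[OF assms(1), symmetric]
            mult.commute[of q m])
    then show ?thesis
      using nonneg_mat_mult[OF pow_carrier_mat[OF A] pow_carrier_mat[OF A]]
        nonneg_mat_pow[OF A] v assms(4) by simp
  qed
  moreover have "square_mat (A ^\<^sub>m q)" using assms(1) by auto
  ultimately show ?thesis unfolding eventually_nonneg_mat_def by blast
qed

end
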